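(* Let $K\ge2$. For $\mathbf p\in[0,1]^K$ define, with $\inf\varnothing=1$, $$F_{\mathrm{EG}}(\mathbf p)=\inf\left\{\alpha\in(0,1):\ \bigvee_{\ell\le K}\left(\frac1\ell\sum_{i=1}^\ell\left(\log\frac\alpha{p_i}\right)_+\right)\ge1\right\},$$ $$F'_{\mathrm{EG}}(\mathbf p)=\inf\left\{\alpha\in(0,1):\ \bigvee_{\ell\le K}\left(\frac1\ell\sum_{i=1}^\ell\log\frac\alpha{p_i}\right)\ge1\right\},\qquad F'_{\mathrm G}(\mathbf p)=e\,G(\mathbf p).$$ The dominations among ex-p-merging functions $F_{\mathrm{EG}}\le F'_{\mathrm{EG}}\le F'_{\mathrm G}$ are strict. Moreover, $$F'_{\mathrm{EG}}(\mathbf p)=e\left\{\bigwedge_{m=1}^KG(\mathbf p_m)\right\},\qquad F_{\mathrm{EG}}(\mathbf p)=\bigwedge_{\ell=1}^K\left(\bigwedge_{m=1}^\ell e^{\ell/m}G(\mathbf p^\ell_{(m)})\right).$$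
   Context: $\bigvee,\bigwedge$ denote maximum and minimum; $x_+=\max(x,0)$; $\log(\alpha/0)=\infty$. $G(\mathbf q)=\left(\prod_{i=1}^nq_i\right)^{1/n}$ is the geometric mean of a vector $\mathbf q$ with $n$ components; $\mathbf p_m=(p_1,\dots,p_m)$; $\mathbf p^\ell_{(m)}$ is the vector of the $m$ smallest elements of $(p_1,\dots,p_\ell)$. Fix an atomless probability space (one supporting a random variable uniform on $[0,1]$); $\mathcal U^K$ is the set of all $K$-dimensional random vectors (arbitrary joint distribution) with components uniform on $[0,1]$; a vector is exchangeable if its law is invariant under permutations of components. An ex-p-merging function is an increasing (non-decreasing in each component) Borel function $F:[0,1]^K\to[0,1]$ with $\mathbb P(F(\mathbf P)\le\alpha)\le\alpha$ for all $\alpha\in(0,1)$ and all exchangeable $\mathbf P\in\mathcal U^K$. A function $F$ dominates a function $F^\circ$ if $F(\mathbf p)\le F^\circ(\mathbf p)$ for all $\mathbf p$, and the domination is strict if $F(\mathbf p)<F^\circ(\mathbf p)$ for at least one $\mathbf p$.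
   Formalization: The right-hand sides of the two displayed formulas are truncated at 1, and F'_G is shown to be an ex-p-merging function after truncation min(eG,1); at p=(1,…,1) the untruncated values are e, while F_EG=F'_EG=1. *)

theory Defs
  imports "HOL-Probability.Probability"
begin

text \<open>
  Vectors with \<open>K\<close> components are functions on the index set \<open>{1..K}\<close>
  (extensional, hence equal to \<open>undefined\<close> elsewhere).
  \<open>cube_algebra K\<close> has \<open>cube K\<close> as its space; being a finite product of copies of the
  Borel space of \<open>[0,1]\<close>, it is the Borel space of \<open>[0,1]\<close> to the power \<open>K\<close>.
\<close>

definition cube :: "nat \<Rightarrow> (nat \<Rightarrow> real) set" where
  "cube K = {1..K} \<rightarrow>\<^sub>E {0..1}"

definition cube_algebra :: "nat \<Rightarrow> (nat \<Rightarrow> real) measure" where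
  "cube_algebra K = PiM {1..K} (\<lambda>_. restrict_space borel {0..1})"

definition unif01 :: "real measure" where
  "unif01 = uniform_measure lborel {0..1}"

text \<open>Atomlessness in the form in which it is used: there is a random variable uniform on \<open>[0,1]\<close>.\<close>

definition atomless_prob_space :: "'w measure \<Rightarrow> bool" where
  "atomless_prob_space M \<longleftrightarrow>
     prob_space M \<and> (\<exists>U \<in> borel_measurable M. distr M borel U = unif01)"

text \<open>The set \<open>\<U>\<^sup>K\<close> of random vectors with arbitrary dependence and uniform components.\<close>

definition uniform_vectors :: "'w measure \<Rightarrow> nat \<Rightarrow> ('w \<Rightarrow> nat \<Rightarrow> real) set" where
  "uniform_vectors M K =
     {P \<in> M \<rightarrow>\<^sub>M cube_algebra K. \<forall>i\<in>{1..K}. distr M borel (\<lambda>w. P w i) = unif01}"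

definition exchangeable :: "'w measure \<Rightarrow> nat \<Rightarrow> ('w \<Rightarrow> nat \<Rightarrow> real) \<Rightarrow> bool" where
  "exchangeable M K P \<longleftrightarrow>
     (\<forall>\<pi>. \<pi> permutes {1..K} \<longrightarrow>
        distr M (cube_algebra K) (\<lambda>w. \<lambda>i\<in>{1..K}. P w (\<pi> i)) = distr M (cube_algebra K) P)"

definition increasing_on_cube :: "nat \<Rightarrow> ((nat \<Rightarrow> real) \<Rightarrow> real) \<Rightarrow> bool" where
  "increasing_on_cube K F \<longleftrightarrow>
     (\<forall>p\<in>cube K. \<forall>q\<in>cube K. (\<forall>i\<in>{1..K}. p i \<le> q i) \<longrightarrow> F p \<le> F q)"

definition ex_p_merging :: "'w measure \<Rightarrow> nat \<Rightarrow> ((nat \<Rightarrow> real) \<Rightarrow> real) \<Rightarrow> bool" where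
  "ex_p_merging M K F \<longleftrightarrow>
     (\<forall>p\<in>cube K. F p \<in> {0..1}) \<and>
     increasing_on_cube K F \<and>
     F \<in> borel_measurable (cube_algebra K) \<and>
     (\<forall>\<alpha>\<in>{0<..<1}. \<forall>P\<in>uniform_vectors M K. exchangeable M K P \<longrightarrow>
        measure M {w \<in> space M. F (P w) \<le> \<alpha>} \<le> \<alpha>)"

definition dominates ::
    "nat \<Rightarrow> ((nat \<Rightarrow> real) \<Rightarrow> real) \<Rightarrow> ((nat \<Rightarrow> real) \<Rightarrow> real) \<Rightarrow> bool" where
  "dominates K F F\<^sub>0 \<longleftrightarrow> (\<forall>p\<in>cube K. F p \<le> F\<^sub>0 p)"

definition strictly_dominates ::
    "nat \<Rightarrow> ((nat \<Rightarrow> real) \<Rightarrow> real) \<Rightarrow> ((nat \<Rightarrow> real) \<Rightarrow> real) \<Rightarrow> bool" where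
  "strictly_dominates K F F\<^sub>0 \<longleftrightarrow> dominates K F F\<^sub>0 \<and> (\<exists>p\<in>cube K. F p < F\<^sub>0 p)"

definition geom_mean :: "real list \<Rightarrow> real" where
  "geom_mean q = root (length q) (prod_list q)"

definition prefix_vec :: "(nat \<Rightarrow> real) \<Rightarrow> nat \<Rightarrow> real list" where
  "prefix_vec p m = map p [1..<Suc m]"

definition smallest_vec :: "(nat \<Rightarrow> real) \<Rightarrow> nat \<Rightarrow> nat \<Rightarrow> real list" where
  "smallest_vec p l m = take m (sort (prefix_vec p l))"

text \<open>
  \<open>log_ratio \<alpha> x\<close> is \<open>log (\<alpha> / x)\<close> with \<open>log (\<alpha> / 0) = \<infinity>\<close>. For \<open>\<alpha> > 0\<close> and \<open>x\<close> in \<open>[0,1]\<close> it is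
  never \<open>-\<infinity>\<close>, so the extended-real sums below involve no \<open>\<infinity> - \<infinity>\<close>.
\<close>

definition log_ratio :: "real \<Rightarrow> real \<Rightarrow> ereal" where
  "log_ratio \<alpha> x = (if x = 0 then \<infinity> else ereal (ln (\<alpha> / x)))"

text \<open>Infimum of a set of levels in \<open>(0,1)\<close>, where the empty set has infimum \<open>1\<close>.\<close>

definition inf_level :: "real set \<Rightarrow> real" where
  "inf_level A = (if A = {} then 1 else Inf A)"

definition F_EG :: "nat \<Rightarrow> (nat \<Rightarrow> real) \<Rightarrow> real" where
  "F_EG K p = inf_level {\<alpha> \<in> {0<..<1}.
     (MAX l\<in>{1..K}. ereal (1 / real l) * (\<Sum>i=1..l. max (log_ratio \<alpha> (p i)) 0)) \<ge> 1}"

definition F_EG' :: "nat \<Rightarrow> (nat \<Rightarrow> real) \<Rightarrow> real" where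
  "F_EG' K p = inf_level {\<alpha> \<in> {0<..<1}.
     (MAX l\<in>{1..K}. ereal (1 / real l) * (\<Sum>i=1..l. log_ratio \<alpha> (p i))) \<ge> 1}"

definition F_G' :: "nat \<Rightarrow> (nat \<Rightarrow> real) \<Rightarrow> real" where
  "F_G' K p = exp 1 * geom_mean (prefix_vec p K)"

text \<open>
  \<open>F_G'\<close> takes values up to \<open>exp 1\<close>; as a merging function with values in \<open>[0,1]\<close>
  it is understood to be truncated at \<open>1\<close>.
\<close>

definition trunc1 :: "((nat \<Rightarrow> real) \<Rightarrow> real) \<Rightarrow> (nat \<Rightarrow> real) \<Rightarrow> real" where
  "trunc1 F p = min (F p) 1"

end

theory Submission
  imports Defs "HOL-Real_Asymp.Real_Asymp"
begin

text \<open>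
  Taking logarithms, \<open>F_EG' K p \<le> \<alpha>\<close> means that some prefix average of \<open>log (\<alpha> / p\<^sub>i)\<close> reaches \<open>1\<close>,
  i.e. that \<open>e\<close> times a prefix geometric mean is at most \<open>\<alpha>\<close>. With positive parts, the sum over a
  prefix is the largest partial sum over its smallest elements, which gives the formula for \<open>F_EG\<close>.

  Validity of \<open>F_EG\<close> comes from a maximal form of Markov's inequality. For nonnegative
  exchangeable \<open>X\<^sub>i\<close> with partial sums \<open>S\<^sub>l\<close>, let \<open>\<tau>\<close> be the last index with \<open>l \<le> S\<^sub>l\<close>. The event
  \<open>\<tau> = l\<close> is symmetric in \<open>X\<^sub>1, \<dots>, X\<^sub>l\<close>, so \<open>l P(\<tau> = l) \<le> E(S\<^sub>l; \<tau> = l) = l E(X\<^sub>1; \<tau> = l)\<close>; summing over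
  \<open>l\<close> bounds the probability that some average reaches \<open>1\<close> by \<open>E X\<^sub>1\<close>. For \<open>X\<^sub>i = (log (\<alpha> / P\<^sub>i))\<^sub>+\<close> this
  expectation is \<open>\<alpha>\<close>. The other two functions lie above \<open>F_EG\<close> and inherit validity.
\<close>

section \<open>A maximal Markov inequality for exchangeable laws\<close>

text \<open>Stating the bound for the law \<open>D\<close> turns exchangeability into an equation of
  measures, so that each permutation becomes a change of variables. Values in \<open>ennreal\<close>
  let \<open>f\<close> be infinite at a point, as the log ratio is at 0, without an integrability
  condition.\<close>

lemma exchangeable_Markov:
  fixes N :: "'a measure" and D :: "(nat \<Rightarrow> 'a) measure" and f :: "'a \<Rightarrow> ennreal"
  assumes sets_D: "sets D = sets (PiM {1..K} (\<lambda>_. N))"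
    and invariant: "\<And>\<pi>. \<pi> permutes {1..K} \<Longrightarrow> distr D D (\<lambda>x. \<lambda>i\<in>{1..K}. x (\<pi> i)) = D"
    and f[measurable]: "f \<in> borel_measurable N"
  shows "emeasure D {x \<in> space D. \<exists>l\<in>{1..K}. of_nat l \<le> (\<Sum>i=1..l. f (x i))} \<le> (\<integral>\<^sup>+x. f (x 1) \<partial>D)"
proof -
  note sets_D[measurable_cong]
  define S where "S l x = (\<Sum>i=1..l. f (x i))" for l and x :: "nat \<Rightarrow> 'a"
  \<comment> \<open>The last index is chosen, not the first: this event constrains only
    \<open>S j\<close> with \<open>j \<ge> l\<close>, and these sums do not change when the first
    \<open>l\<close> coordinates are permuted. A first crossing would constrain the shorter sums,
    which do change.\<close>
  define E where "E l = {x \<in> space D. of_nat l \<le> S l x \<and> (\<forall>j\<in>{l<..K}. S j x < of_nat j)}" for l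
  have f_coord[measurable]: "(\<lambda>x. f (x i)) \<in> borel_measurable D" if "i \<in> {1..K}" for i
    using that by measurable
  have S_measurable: "S l \<in> borel_measurable D" if "l \<le> K" for l
    unfolding S_def using that by (intro borel_measurable_sum f_coord) auto
  have E_sets: "E l \<in> sets D" if "l \<le> K" for l
  proof -
    have 1: "{x \<in> space D. of_nat l \<le> S l x} \<in> sets D"
      using S_measurable[OF that] by measurable
    have 2: "{x \<in> space D. S j x < of_nat j} \<in> sets D" if "j \<in> {l<..K}" for j
    proof -
      have [measurable]: "S j \<in> borel_measurable D"
        using S_measurable that by simp
      show ?thesis by measurable
    qed
    have "{x \<in> space D. \<forall>j\<in>{l<..K}. S j x < of_nat j} \<in> sets D"
      by (rule sets.sets_Collect_finite_All) (auto intro: 2)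
    with 1 show ?thesis
      unfolding E_def by (intro sets.sets_Collect_conj)
  qed
  have swap: "(\<integral>\<^sup>+x. f (x i) * indicator (E l) x \<partial>D) = (\<integral>\<^sup>+x. f (x 1) * indicator (E l) x \<partial>D)"
    if l: "l \<in> {1..K}" and i: "i \<in> {1..l}" for l i
  proof -
    \<comment> \<open>As \<open>i \<le> l\<close>, exchanging 1 and \<open>i\<close> maps
      \<open>{1..j}\<close> onto itself for every \<open>j \<ge> l\<close>. Hence it preserves
      \<open>E l\<close>, while it carries \<open>f (x i)\<close> to \<open>f (x 1)\<close>.\<close>
    define \<pi> where "\<pi> = Transposition.transpose 1 i"
    have \<pi>l: "\<pi> permutes {1..j}" if "l \<le> j" for j
      unfolding \<pi>_def using i that by (intro permutes_swap_id) auto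
    have \<pi>K: "\<pi> permutes {1..K}"
      using l by (intro \<pi>l) auto
    define t where "t = (\<lambda>x::nat \<Rightarrow> 'a. \<lambda>i\<in>{1..K}. x (\<pi> i))"
    have t[measurable]: "t \<in> D \<rightarrow>\<^sub>M D"
    proof -
      have "t \<in> PiM {1..K} (\<lambda>_. N) \<rightarrow>\<^sub>M PiM {1..K} (\<lambda>_. N)"
        unfolding t_def
        using permutes_in_image[OF \<pi>K] by (intro measurable_restrict measurable_component_singleton) auto
      then show ?thesis
        by (simp cong: measurable_cong_sets add: sets_D)
    qed
    have S_t: "S j (t x) = S j x" if "j \<in> {l..K}" for j x
    proof -
      have "S j (t x) = (\<Sum>i=1..j. f (x (\<pi> i)))"
        unfolding S_def t_def using that by (intro sum.cong) auto
      also have "\<dots> = S j x"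
        unfolding S_def using sum.permute[OF \<pi>l[of j], of "\<lambda>i. f (x i)"] that by (simp add: o_def)
      finally show ?thesis .
    qed
    have E_t: "indicator (E l) (t x) = (indicator (E l) x :: ennreal)" if "x \<in> space D" for x
    proof -
      have "t x \<in> E l \<longleftrightarrow> x \<in> E l"
        using that measurable_space[OF t that] l S_t[of _ x] unfolding E_def by auto
      then show ?thesis by (auto simp: indicator_def)
    qed
    have "(\<integral>\<^sup>+x. f (x i) * indicator (E l) x \<partial>D) = (\<integral>\<^sup>+x. f (x i) * indicator (E l) x \<partial>distr D D t)"
      using invariant[OF \<pi>K] by (simp add: t_def)
    also have "\<dots> = (\<integral>\<^sup>+x. f (t x i) * indicator (E l) (t x) \<partial>D)"
      using l i E_sets[of l] by (intro nn_integral_distr t borel_measurable_times_ennreal f_coord borel_measurable_indicator) auto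
    also have "\<dots> = (\<integral>\<^sup>+x. f (x 1) * indicator (E l) x \<partial>D)"
      using l i E_t by (intro nn_integral_cong) (auto simp: t_def \<pi>_def)
    finally show ?thesis .
  qed
  have E_le: "emeasure D (E l) \<le> (\<integral>\<^sup>+x. f (x 1) * indicator (E l) x \<partial>D)" if l: "l \<in> {1..K}" for l
  proof -
    have "of_nat l * emeasure D (E l) = (\<integral>\<^sup>+x. of_nat l * indicator (E l) x \<partial>D)"
      using E_sets[of l] l by (simp add: nn_integral_cmult_indicator)
    also have "\<dots> \<le> (\<integral>\<^sup>+x. (\<Sum>i=1..l. f (x i) * indicator (E l) x) \<partial>D)"
      by (intro nn_integral_mono) (auto simp: indicator_def E_def S_def)
    also have "\<dots> = (\<Sum>i=1..l. \<integral>\<^sup>+x. f (x i) * indicator (E l) x \<partial>D)"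
      using l E_sets[of l] by (intro nn_integral_sum borel_measurable_times_ennreal f_coord borel_measurable_indicator) auto
    also have "\<dots> = (\<Sum>i=1..l. \<integral>\<^sup>+x. f (x 1) * indicator (E l) x \<partial>D)"
      by (intro sum.cong refl swap[OF l])
    also have "\<dots> = of_nat l * (\<integral>\<^sup>+x. f (x 1) * indicator (E l) x \<partial>D)"
      by simp
    finally show ?thesis
      using l by (subst (asm) ennreal_mult_le_mult_iff) (auto simp: of_nat_less_top)
  qed
  have union: "{x \<in> space D. \<exists>l\<in>{1..K}. of_nat l \<le> (\<Sum>i=1..l. f (x i))} = (\<Union>l\<in>{1..K}. E l)"
  proof (intro equalityI subsetI)
    fix x assume x: "x \<in> {x \<in> space D. \<exists>l\<in>{1..K}. of_nat l \<le> (\<Sum>i=1..l. f (x i))}"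
    define L where "L = {l \<in> {1..K}. of_nat l \<le> S l x}"
    have "finite L" "L \<noteq> {}" using x by (auto simp: L_def S_def)
    then have m: "Max L \<in> L" and max: "\<And>j. j \<in> L \<Longrightarrow> j \<le> Max L" by auto
    have "S j x < of_nat j" if "j \<in> {Max L<..K}" for j
    proof (rule ccontr)
      assume "\<not> S j x < of_nat j"
      with that have "j \<in> L" by (auto simp: L_def)
      with max[of j] that show False by simp
    qed
    with m x have "x \<in> E (Max L)" "Max L \<in> {1..K}"
      by (auto simp: L_def E_def)
    then show "x \<in> (\<Union>l\<in>{1..K}. E l)" by blast
  qed (auto simp: E_def S_def)
  have disj: "disjoint_family_on E {1..K}"
    unfolding disjoint_family_on_def E_def
    by (auto; metis greaterThanAtMost_iff linorder_neqE_nat not_le)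
  have "emeasure D (\<Union>l\<in>{1..K}. E l) = (\<Sum>l=1..K. emeasure D (E l))"
    using disj E_sets by (intro sum_emeasure[symmetric]) auto
  also have "\<dots> \<le> (\<Sum>l=1..K. \<integral>\<^sup>+x. f (x 1) * indicator (E l) x \<partial>D)"
    by (intro sum_mono E_le)
  also have "\<dots> = (\<integral>\<^sup>+x. (\<Sum>l=1..K. f (x 1) * indicator (E l) x) \<partial>D)"
    using E_sets by (intro nn_integral_sum[symmetric] borel_measurable_times_ennreal f_coord borel_measurable_indicator) auto
  also have "\<dots> \<le> (\<integral>\<^sup>+x. f (x 1) \<partial>D)"
  proof (intro nn_integral_mono)
    fix x
    have "(\<Sum>l=1..K. f (x 1) * indicator (E l) x) = f (x 1) * indicator (\<Union>l\<in>{1..K}. E l) x"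
      using disj by (simp add: indicator_UN_disjoint sum_distrib_left)
    also have "\<dots> \<le> f (x 1)" by (auto simp: indicator_def)
    finally show "(\<Sum>l=1..K. f (x 1) * indicator (E l) x) \<le> f (x 1)" .
  qed
  finally show ?thesis unfolding union .
qed

section \<open>Mean of the positive log ratio of a uniform variable\<close>

lemma has_integral_ln_ratio:
  assumes "0 < (\<alpha>::real)"
  shows "((\<lambda>x. ln (\<alpha> / x)) has_integral \<alpha>) {0..\<alpha>}"
proof -
  \<comment> \<open>The added \<open>x\<close> cancels the -1 that arises from differentiating the
    logarithm. The factor \<open>x\<close> gives \<open>F 0 = 0\<close>, which is also the limit
    from the right, so \<open>F\<close> is continuous on the closed interval although the derivative
    is available only away from 0.\<close>
  define F where "F x = x * ln (\<alpha> / x) + x" for x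
  have deriv: "(F has_field_derivative ln (\<alpha> / x)) (at x)" if "0 < x" for x
    unfolding F_def using assms that
    by (auto intro!: derivative_eq_intros simp: field_simps)
  have "continuous_on {0..\<alpha>} F"
    unfolding continuous_on_def
  proof
    fix x assume x: "x \<in> {0..\<alpha>}"
    show "(F \<longlongrightarrow> F x) (at x within {0..\<alpha>})"
    proof (cases "x = 0")
      case True
      have "(F \<longlongrightarrow> 0) (at_right 0)"
        unfolding F_def using assms by real_asymp
      then show ?thesis
        using True assms by (simp add: F_def at_within_Icc_at_right)
    next
      case False
      then have "isCont F x"
        using x by (intro DERIV_isCont[OF deriv]) auto
      then show ?thesis
        by (auto simp: isCont_def intro: tendsto_within_subset)
    qed
  qed
  then have "((\<lambda>x. ln (\<alpha> / x)) has_integral F \<alpha> - F 0) {0..\<alpha>}"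
    using assms deriv
    by (intro fundamental_theorem_of_calculus_interior)
       (auto simp flip: has_real_derivative_iff_has_vector_derivative)
  then show ?thesis
    using assms by (simp add: F_def)
qed

lemma borel_measurable_log_ratio[measurable]: "log_ratio \<alpha> \<in> borel_measurable borel"
  unfolding log_ratio_def[abs_def] by measurable

text \<open>The positive part vanishes beyond \<alpha>, and \<alpha> < 1 keeps
  \<open>{0..\<alpha>}\<close> inside the unit interval, so the integral of
  \<open>ln (\<alpha> / x)\<close> over \<open>{0..\<alpha>}\<close> remains. This is the mean that
  enters the Markov bound.\<close>

lemma nn_integral_log_ratio:
  assumes "\<alpha> \<in> {0<..<1}"
  shows "(\<integral>\<^sup>+x. e2ennreal (max (log_ratio \<alpha> x) 0) \<partial>unif01) = ennreal \<alpha>"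
proof -
  have "(\<integral>\<^sup>+x. e2ennreal (max (log_ratio \<alpha> x) 0) \<partial>unif01) =
      (\<integral>\<^sup>+x. e2ennreal (max (log_ratio \<alpha> x) 0) * indicator {0..1} x \<partial>lborel)"
    unfolding unif01_def by (subst nn_integral_uniform_measure) (auto simp: divide_ennreal_def)
  also have "\<dots> = (\<integral>\<^sup>+x. ennreal (ln (\<alpha> / x)) * indicator {0..\<alpha>} x \<partial>lborel)"
  proof (intro nn_integral_cong_AE)
    show "AE x in lborel. e2ennreal (max (log_ratio \<alpha> x) 0) * indicator {0..1} x =
        ennreal (ln (\<alpha> / x)) * indicator {0..\<alpha>} x"
      \<comment> \<open>The integrands differ at 0, where \<open>log_ratio\<close> is infinite but
        the real logarithm is finite; a single point is null.\<close>
      using AE_lborel_singleton[of 0]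
    proof eventually_elim
      case (elim x)
      then have lr: "e2ennreal (max (log_ratio \<alpha> x) 0) = ennreal (max (ln (\<alpha> / x)) 0)"
        by (simp add: log_ratio_def max_def)
      show ?case
        unfolding lr using elim assms by (auto simp: indicator_def max_def ennreal_neg)
    qed
  qed
  also have "\<dots> = ennreal \<alpha>"
  proof (intro nn_integral_has_integral_lebesgue' has_integral_ln_ratio)
    show "0 \<le> ln (\<alpha> / x)" if "x \<in> {0..\<alpha>}" for x
      using that by (cases "x = 0") auto
  qed (use assms in auto)
  finally show ?thesis .
qed

section \<open>Sums of log ratios and geometric means\<close>

text \<open>For positive entries the sum is \<open>n * ln \<alpha> - ln (prod_list xs)\<close>;
  divide by \<open>n\<close> and exponentiate. A zero entry makes the sum infinite and the geometric
  mean 0, so both sides hold. The threshold \<open>s\<close> is separate from the length because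
  \<open>F_EG\<close> compares the sum over \<open>m\<close> entries with some
  \<open>l \<ge> m\<close>.\<close>

lemma sum_list_log_ratio_ge_iff:
  assumes "0 < \<alpha>" "xs \<noteq> []" "set xs \<subseteq> {0..}"
  shows "ereal s \<le> sum_list (map (log_ratio \<alpha>) xs) \<longleftrightarrow>
    exp (s / real (length xs)) * geom_mean xs \<le> \<alpha>"
proof (cases "0 \<in> set xs")
  case True
  have not_minf: "sum_list (map (log_ratio \<alpha>) ys) \<noteq> -\<infinity>" for ys
    by (induction ys) (auto simp: log_ratio_def)
  have "sum_list (map (log_ratio \<alpha>) xs) = \<infinity>"
    using True
  proof (induction xs)
    case (Cons x xs)
    then show ?case
      using not_minf[of xs] by (cases "x = 0") (auto simp: log_ratio_def)
  qed simp
  moreover have "prod_list xs = 0"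
    using True by (simp add: prod_list_zero_iff)
  then have "geom_mean xs = 0"
    using assms by (simp add: geom_mean_def)
  ultimately show ?thesis
    using assms by simp
next
  case False
  with assms have pos: "\<forall>x\<in>set xs. 0 < x"
    by (auto simp: order_less_le)
  then have prod_pos: "0 < prod_list xs"
    by (induction xs) auto
  define n where "n = length xs"
  have n: "0 < n"
    using assms by (simp add: n_def)
  have sum: "sum_list (map (log_ratio \<alpha>) xs) = ereal (n * ln \<alpha> - ln (prod_list xs))"
    unfolding n_def using pos
  proof (induction xs)
    case (Cons x xs)
    have "0 < prod_list xs"
      using Cons.prems by (induction xs) auto
    then show ?case
      using Cons assms(1) by (simp add: log_ratio_def ln_mult ln_div algebra_simps)
  qed (simp add: zero_ereal_def)
  have gm: "geom_mean xs = exp (ln (prod_list xs) / n)"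
    using prod_pos n by (simp add: geom_mean_def root_powr_inverse powr_def n_def field_simps)
  have "exp (s / n) * geom_mean xs \<le> \<alpha> \<longleftrightarrow> exp (s / n + ln (prod_list xs) / n) \<le> exp (ln \<alpha>)"
    using assms(1) by (simp add: gm exp_add)
  also have "\<dots> \<longleftrightarrow> s \<le> n * ln \<alpha> - ln (prod_list xs)"
    using n by (simp add: field_simps)
  finally show ?thesis
    by (simp add: sum flip: n_def)
qed

lemma log_ratio_antimono:
  assumes "0 < \<alpha>" "0 \<le> x" "x \<le> y"
  shows "log_ratio \<alpha> y \<le> log_ratio \<alpha> x"
proof (cases "x = 0")
  case False
  with assms have "\<alpha> / y \<le> \<alpha> / x" "0 < \<alpha> / y"
    by (simp_all add: frac_le)
  with assms False show ?thesis
    by (simp add: log_ratio_def)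
qed (simp add: log_ratio_def)

text \<open>In a decreasing list the nonnegative entries come first, so dropping the negative ones
  leaves a prefix. Together with \<open>sum_list_take_le_max_0\<close> this identifies the sum of
  positive parts as the largest prefix sum.\<close>

lemma sum_list_max_0_sorted:
  fixes zs :: "ereal list"
  assumes "sorted_wrt (\<ge>) zs"
  shows "\<exists>m\<le>length zs. sum_list (map (\<lambda>z. max z 0) zs) = sum_list (take m zs)"
  using assms
proof (induction zs)
  case (Cons z zs)
  show ?case
  proof (cases "0 \<le> z")
    case True
    obtain m where "m \<le> length zs" "sum_list (map (\<lambda>z. max z 0) zs) = sum_list (take m zs)"
      using Cons by auto
    with True show ?thesis
      by (intro exI[of _ "Suc m"]) (auto simp: max_def)
  next
    case False
    \<comment> \<open>Once the head is negative, so are all later entries, and the empty prefix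
      works.\<close>
    then have "\<forall>y\<in>set (z # zs). max y 0 = 0"
      using Cons.prems by (auto simp: max_def)
    then have "map (\<lambda>z. max z 0) (z # zs) = map (\<lambda>z. 0) (z # zs)"
      by (intro map_cong refl) blast
    then have "sum_list (map (\<lambda>z. max z 0) (z # zs)) = sum_list (take 0 (z # zs))"
      by (simp only: sum_list_0 take0 sum_list.Nil)
    then show ?thesis
      by blast
  qed
qed simp

lemma sum_list_take_le_max_0:
  fixes zs :: "ereal list"
  shows "sum_list (take m zs) \<le> sum_list (map (\<lambda>z. max z 0) zs)"
proof (induction zs arbitrary: m)
  case (Cons z zs)
  have "0 \<le> sum_list (map (\<lambda>z. max z 0) zs)"
    by (intro sum_list_nonneg) auto
  with Cons show ?case
    by (cases m) (auto intro!: add_mono simp: add_nonneg_nonneg)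
qed simp

text \<open>\<open>log_ratio \<alpha>\<close> is antitone, so sorting the entries upwards sorts
  their log ratios downwards. The largest prefix sum is then taken over the \<open>m\<close>
  smallest entries.\<close>

lemma sum_list_positive_log_ratio_ge_iff:
  assumes "0 < \<alpha>" "0 < s" "set xs \<subseteq> {0..}"
  shows "ereal s \<le> sum_list (map (\<lambda>x. max (log_ratio \<alpha> x) 0) xs) \<longleftrightarrow>
    (\<exists>m\<in>{1..length xs}. exp (s / real m) * geom_mean (take m (sort xs)) \<le> \<alpha>)"
proof -
  define zs where "zs = map (log_ratio \<alpha>) (sort xs)"
  have len: "length zs = length xs"
    by (simp add: zs_def)
  have sorted: "sorted_wrt (\<ge>) zs"
    unfolding zs_def sorted_wrt_map
    using assms by (intro sorted_wrt_mono_rel[OF _ sorted_sort]) (auto intro!: log_ratio_antimono)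
  have sum: "sum_list (map (\<lambda>x. max (log_ratio \<alpha> x) 0) xs) = sum_list (map (\<lambda>z. max z 0) zs)"
  proof -
    have "mset (map (\<lambda>x. max (log_ratio \<alpha> x) 0) xs) = mset (map (\<lambda>z. max z 0) zs)"
      by (simp add: zs_def comp_def)
    then show ?thesis
      by (metis sum_mset_sum_list)
  qed
  have take: "ereal s \<le> sum_list (take m zs) \<longleftrightarrow> exp (s / real m) * geom_mean (take m (sort xs)) \<le> \<alpha>"
    if "m \<in> {1..length xs}" for m
  proof -
    have "set (take m (sort xs)) \<subseteq> {0..}"
      using assms(3) set_take_subset[of m "sort xs"] by auto
    moreover have "take m (sort xs) \<noteq> []"
      using that by (auto simp flip: length_0_conv)
    ultimately show ?thesis
      using sum_list_log_ratio_ge_iff[OF assms(1), of "take m (sort xs)" s] that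
      by (simp add: zs_def take_map)
  qed
  have "ereal s \<le> sum_list (map (\<lambda>z. max z 0) zs) \<longleftrightarrow> (\<exists>m\<in>{1..length xs}. ereal s \<le> sum_list (take m zs))"
  proof
    assume *: "ereal s \<le> sum_list (map (\<lambda>z. max z 0) zs)"
    obtain m where m: "m \<le> length zs" "sum_list (map (\<lambda>z. max z 0) zs) = sum_list (take m zs)"
      using sum_list_max_0_sorted[OF sorted] by blast
    \<comment> \<open>The empty prefix has sum 0 and cannot reach the positive threshold
      \<open>s\<close>.\<close>
    then have "m \<noteq> 0"
      using * assms(2) by (intro notI) auto
    with m * len show "\<exists>m\<in>{1..length xs}. ereal s \<le> sum_list (take m zs)"
      by (intro bexI[of _ m]) auto
  qed (use sum_list_take_le_max_0 order_trans in blast)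
  then show ?thesis
    using take by (simp add: sum)
qed

section \<open>Closed formulas and sublevel sets of the two functions\<close>

text \<open>The admissible levels form an interval starting at \<open>c\<close>. It is empty when
  \<open>c \<ge> 1\<close>, where the convention for the empty infimum yields the cap; for
  \<open>c = 0\<close> the infimum is 0 without being attained.\<close>

lemma inf_level_threshold:
  assumes "0 \<le> c" and "\<And>\<alpha>. \<alpha> \<in> {0<..<1} \<Longrightarrow> Q \<alpha> \<longleftrightarrow> c \<le> \<alpha>"
  shows "inf_level {\<alpha> \<in> {0<..<1}. Q \<alpha>} = min c 1"
proof -
  have eq: "{\<alpha> \<in> {0<..<1}. Q \<alpha>} = {\<alpha> \<in> {0<..<1}. c \<le> \<alpha>}"
    using assms(2) by blast
  consider "1 \<le> c" | "c = 0" | "0 < c" "c < 1"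
    using assms(1) by linarith
  then show ?thesis
  proof cases
    case 1
    then have "{\<alpha> \<in> {0<..<1}. c \<le> \<alpha>} = {}" by auto
    with 1 show ?thesis unfolding eq by (simp add: inf_level_def)
  next
    case 2
    then have "{\<alpha> \<in> {0<..<1}. c \<le> \<alpha>} = {0<..<1}" by auto
    with 2 show ?thesis unfolding eq by (simp add: inf_level_def)
  next
    case 3
    then have "{\<alpha> \<in> {0<..<1}. c \<le> \<alpha>} = {c..<1}" by auto
    with 3 show ?thesis unfolding eq by (simp add: inf_level_def)
  qed
qed

lemma ereal_average_ge_1_iff:
  assumes "0 < l"
  shows "1 \<le> ereal (1 / real l) * S \<longleftrightarrow> ereal (real l) \<le> S"
proof -
  have "1 = ereal (1 / real l) * ereal (real l)"
    using assms by (simp add: one_ereal_def)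
  then have "1 \<le> ereal (1 / real l) * S \<longleftrightarrow> ereal (1 / real l) * ereal (real l) \<le> ereal (1 / real l) * S"
    by (simp only:)
  also have "\<dots> \<longleftrightarrow> ereal (real l) \<le> S"
    using assms by (subst ereal_mult_le_mult_iff) auto
  finally show ?thesis .
qed

lemma Max_average_ge_1_iff:
  assumes "1 \<le> K"
  shows "1 \<le> (MAX l\<in>{1..K}. ereal (1 / real l) * S l) \<longleftrightarrow> (\<exists>l\<in>{1..K}. ereal (real l) \<le> S l)"
  using assms by (subst Max_ge_iff) (auto simp: ereal_average_ge_1_iff)

lemma length_prefix_vec[simp]: "length (prefix_vec p l) = l"
  by (simp add: prefix_vec_def)

lemma set_prefix_vec: "set (prefix_vec p l) = p ` {1..l}"
  by (auto simp: prefix_vec_def)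

lemma sum_prefix_vec: "(\<Sum>i=1..l. g (p i)) = sum_list (map g (prefix_vec p l))"
proof -
  have "{1..l} = set [1..<Suc l]" by auto
  then show ?thesis
    by (simp only: sum.distinct_set_conv_list distinct_upt prefix_vec_def map_map comp_def)
qed

lemma geom_mean_prefix_vec: "geom_mean (prefix_vec p l) = root l (\<Prod>i=1..l. p i)"
proof -
  have "{1..l} = set [1..<Suc l]" by auto
  then have "prod p {1..l} = prod_list (prefix_vec p l)"
    by (simp only: prod.distinct_set_conv_list distinct_upt prefix_vec_def)
  then show ?thesis
    by (simp add: geom_mean_def)
qed

lemma geom_mean_nonneg:
  assumes "set xs \<subseteq> {0..}"
  shows "0 \<le> geom_mean xs"
proof -
  have "0 \<le> prod_list xs"
    using assms by (induction xs) auto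
  then show ?thesis
    by (cases "xs = []") (simp_all add: geom_mean_def)
qed

lemma prefix_vec_nonneg: "p \<in> cube K \<Longrightarrow> l \<le> K \<Longrightarrow> set (prefix_vec p l) \<subseteq> {0..}"
  by (fastforce simp: cube_def set_prefix_vec PiE_iff)

lemma smallest_vec_nonneg: "p \<in> cube K \<Longrightarrow> l \<le> K \<Longrightarrow> set (smallest_vec p l m) \<subseteq> {0..}"
  using prefix_vec_nonneg[of p K l] set_take_subset[of m "sort (prefix_vec p l)"]
  by (auto simp: smallest_vec_def)

text \<open>Here the threshold equals the number of summands, so the exponent is 1 for every prefix
  and the common factor \<open>exp 1\<close> leaves the minimum.\<close>

lemma F_EG'_level:
  assumes p: "p \<in> cube K" and K: "1 \<le> K" and \<alpha>: "0 < \<alpha>"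
  shows "1 \<le> (MAX l\<in>{1..K}. ereal (1 / real l) * (\<Sum>i=1..l. log_ratio \<alpha> (p i))) \<longleftrightarrow>
    exp 1 * (MIN m\<in>{1..K}. geom_mean (prefix_vec p m)) \<le> \<alpha>"
proof -
  have *: "ereal l \<le> (\<Sum>i=1..l. log_ratio \<alpha> (p i)) \<longleftrightarrow> geom_mean (prefix_vec p l) \<le> \<alpha> / exp 1"
    if "l \<in> {1..K}" for l
  proof -
    have "prefix_vec p l \<noteq> []"
      using that length_prefix_vec[of p l] by force
    then show ?thesis
      using that sum_list_log_ratio_ge_iff[OF \<alpha> _ prefix_vec_nonneg[OF p], of l l]
      by (simp add: sum_prefix_vec[where g="log_ratio \<alpha>", simplified] field_simps)
  qed
  have "exp 1 * (MIN m\<in>{1..K}. geom_mean (prefix_vec p m)) \<le> \<alpha> \<longleftrightarrow>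
      (MIN m\<in>{1..K}. geom_mean (prefix_vec p m)) \<le> \<alpha> / exp 1"
    by (simp add: field_simps)
  also have "\<dots> \<longleftrightarrow> (\<exists>m\<in>{1..K}. geom_mean (prefix_vec p m) \<le> \<alpha> / exp 1)"
    using K by (subst Min_le_iff) auto
  finally show ?thesis
    using * by (simp only: Max_average_ge_1_iff[OF K] cong: bex_cong)
qed

text \<open>The threshold is \<open>l\<close> while only \<open>m\<close> entries contribute, so the
  factor \<open>exp (l / m)\<close> varies and stays inside both minima.\<close>

lemma F_EG_level:
  assumes p: "p \<in> cube K" and K: "1 \<le> K" and \<alpha>: "0 < \<alpha>"
  shows "1 \<le> (MAX l\<in>{1..K}. ereal (1 / real l) * (\<Sum>i=1..l. max (log_ratio \<alpha> (p i)) 0)) \<longleftrightarrow>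
    (MIN l\<in>{1..K}. MIN m\<in>{1..l}. exp (real l / real m) * geom_mean (smallest_vec p l m)) \<le> \<alpha>"
proof -
  have *: "ereal l \<le> (\<Sum>i=1..l. max (log_ratio \<alpha> (p i)) 0) \<longleftrightarrow>
      (MIN m\<in>{1..l}. exp (real l / real m) * geom_mean (smallest_vec p l m)) \<le> \<alpha>"
    if "l \<in> {1..K}" for l
    using that sum_list_positive_log_ratio_ge_iff[OF \<alpha> _ prefix_vec_nonneg[OF p], of l l]
    unfolding sum_prefix_vec[where g="\<lambda>x. max (log_ratio \<alpha> x) 0"]
    by (subst Min_le_iff) (auto simp: smallest_vec_def)
  have "(MIN l\<in>{1..K}. MIN m\<in>{1..l}. exp (real l / real m) * geom_mean (smallest_vec p l m)) \<le> \<alpha> \<longleftrightarrow>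
      (\<exists>l\<in>{1..K}. (MIN m\<in>{1..l}. exp (real l / real m) * geom_mean (smallest_vec p l m)) \<le> \<alpha>)"
    using K by (subst Min_le_iff) auto
  then show ?thesis
    using * by (simp only: Max_average_ge_1_iff[OF K] cong: bex_cong)
qed

text \<open>The cap reflects the infimum 1 of the empty set: at the vector of ones the uncapped
  expression would be \<open>exp 1\<close>.\<close>

lemma F_EG'_eq:
  assumes "p \<in> cube K" "1 \<le> K"
  shows "F_EG' K p = min (exp 1 * (MIN m\<in>{1..K}. geom_mean (prefix_vec p m))) 1"
  unfolding F_EG'_def
proof (rule inf_level_threshold)
  show "0 \<le> exp 1 * (MIN m\<in>{1..K}. geom_mean (prefix_vec p m))"
    using assms geom_mean_nonneg[OF prefix_vec_nonneg]
    by (intro mult_nonneg_nonneg Min.boundedI) auto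
qed (use F_EG'_level[OF assms] in auto)

lemma F_EG_eq:
  assumes "p \<in> cube K" "1 \<le> K"
  shows "F_EG K p = min (MIN l\<in>{1..K}. MIN m\<in>{1..l}.
    exp (real l / real m) * geom_mean (smallest_vec p l m)) 1"
  unfolding F_EG_def
proof (rule inf_level_threshold)
  show "0 \<le> (MIN l\<in>{1..K}. MIN m\<in>{1..l}. exp (real l / real m) * geom_mean (smallest_vec p l m))"
    using assms geom_mean_nonneg[OF smallest_vec_nonneg] by (intro Min.boundedI) auto
qed (use F_EG_level[OF assms] in auto)

lemma F_EG'_le_iff:
  assumes "p \<in> cube K" "1 \<le> K" "\<alpha> \<in> {0<..<1}"
  shows "F_EG' K p \<le> \<alpha> \<longleftrightarrow> (\<exists>m\<in>{1..K}. exp 1 * geom_mean (prefix_vec p m) \<le> \<alpha>)"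
proof -
  have "F_EG' K p \<le> \<alpha> \<longleftrightarrow> (MIN m\<in>{1..K}. geom_mean (prefix_vec p m)) \<le> \<alpha> / exp 1"
    using assms by (simp add: F_EG'_eq field_simps min_le_iff_disj)
  also have "\<dots> \<longleftrightarrow> (\<exists>m\<in>{1..K}. geom_mean (prefix_vec p m) \<le> \<alpha> / exp 1)"
    using assms by (subst Min_le_iff) auto
  finally show ?thesis
    by (simp add: field_simps)
qed

text \<open>A second description of the same sublevel sets. The one by geometric means serves
  monotonicity and measurability; this one serves the comparison with \<open>F_EG\<close> and the
  explicit points.\<close>

lemma F_EG'_le_iff_sum:
  assumes "p \<in> cube K" "1 \<le> K" "\<alpha> \<in> {0<..<1}"
  shows "F_EG' K p \<le> \<alpha> \<longleftrightarrow> (\<exists>l\<in>{1..K}. ereal (real l) \<le> (\<Sum>i=1..l. log_ratio \<alpha> (p i)))"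
proof -
  have "F_EG' K p \<le> \<alpha> \<longleftrightarrow> exp 1 * (MIN m\<in>{1..K}. geom_mean (prefix_vec p m)) \<le> \<alpha>"
    using assms by (simp add: F_EG'_eq min_le_iff_disj)
  also have "\<dots> \<longleftrightarrow> (\<exists>l\<in>{1..K}. ereal (real l) \<le> (\<Sum>i=1..l. log_ratio \<alpha> (p i)))"
    using F_EG'_level[OF assms(1,2)] assms(3) Max_average_ge_1_iff[OF assms(2)] by simp
  finally show ?thesis .
qed

lemma F_EG_le_iff_sum:
  assumes "p \<in> cube K" "1 \<le> K" "\<alpha> \<in> {0<..<1}"
  shows "F_EG K p \<le> \<alpha> \<longleftrightarrow>
    (\<exists>l\<in>{1..K}. ereal (real l) \<le> (\<Sum>i=1..l. max (log_ratio \<alpha> (p i)) 0))"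
proof -
  have "F_EG K p \<le> \<alpha> \<longleftrightarrow>
      (MIN l\<in>{1..K}. MIN m\<in>{1..l}. exp (real l / real m) * geom_mean (smallest_vec p l m)) \<le> \<alpha>"
    using assms by (simp add: F_EG_eq min_le_iff_disj)
  also have "\<dots> \<longleftrightarrow> (\<exists>l\<in>{1..K}. ereal (real l) \<le> (\<Sum>i=1..l. max (log_ratio \<alpha> (p i)) 0))"
    using F_EG_level[OF assms(1,2)] assms(3) Max_average_ge_1_iff[OF assms(2)] by simp
  finally show ?thesis .
qed

text \<open>Rewrites the event in the form of \<open>exchangeable_Markov\<close>. The terms are
  nonnegative, so passing between \<open>ereal\<close> and \<open>ennreal\<close> preserves their
  sums and the order.\<close>

lemma F_EG_le_iff_sum_ennreal:
  assumes "p \<in> cube K" "1 \<le> K" "\<alpha> \<in> {0<..<1}"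
  shows "F_EG K p \<le> \<alpha> \<longleftrightarrow>
    (\<exists>l\<in>{1..K}. of_nat l \<le> (\<Sum>i=1..l. e2ennreal (max (log_ratio \<alpha> (p i)) 0)))"
proof -
  have "enn2ereal (\<Sum>i=1..l. e2ennreal (max (log_ratio \<alpha> (p i)) 0)) =
      (\<Sum>i=1..l. max (log_ratio \<alpha> (p i)) 0)" for l
    by (subst sum_enn2ereal[symmetric]) (auto simp: enn2ereal_e2ennreal)
  then show ?thesis
    by (simp only: less_eq_ennreal.rep_eq enn2ereal_of_nat F_EG_le_iff_sum[OF assms])
qed

section \<open>The measurable cube and criteria for merging functions\<close>

lemma space_cube_algebra: "space (cube_algebra K) = cube K"
  by (simp add: cube_algebra_def cube_def space_PiM space_restrict_space)

lemma measurable_cube_component: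
  assumes "i \<in> {1..K}"
  shows "(\<lambda>p. p i) \<in> borel_measurable (cube_algebra K)"
proof -
  have "(\<lambda>p. p i) \<in> cube_algebra K \<rightarrow>\<^sub>M restrict_space borel {0..1}"
    unfolding cube_algebra_def using assms by (rule measurable_component_singleton)
  then show ?thesis
    by (simp add: measurable_restrict_space2_iff)
qed

text \<open>Sublevel sets are described only at levels strictly between 0 and 1. For
  \<open>0 < a \<le> 1\<close> the set where \<open>F x < a\<close> is the union of those at
  rational levels in \<open>(0, a)\<close>; for other \<open>a\<close> the range makes it empty or
  the whole space.\<close>

lemma borel_measurable_unit_interval_levels:
  fixes F :: "'a \<Rightarrow> real"
  assumes range: "\<And>x. x \<in> space N \<Longrightarrow> F x \<in> {0..1}"
    and levels: "\<And>\<alpha>. \<alpha> \<in> {0<..<1} \<Longrightarrow> {x \<in> space N. F x \<le> \<alpha>} \<in> sets N"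
  shows "F \<in> borel_measurable N"
  unfolding borel_measurable_iff_less
proof
  fix a :: real
  consider "a \<le> 0" | "1 < a" | "0 < a" "a \<le> 1"
    by linarith
  then show "{x \<in> space N. F x < a} \<in> sets N"
  proof cases
    case 1
    then have "{x \<in> space N. F x < a} = {}"
      using range by force
    then show ?thesis by (simp only: sets.empty_sets)
  next
    case 2
    then have "{x \<in> space N. F x < a} = space N"
      using range by force
    then show ?thesis by simp
  next
    case 3
    have "{x \<in> space N. F x < a} = (\<Union>r\<in>\<rat> \<inter> {0<..<a}. {x \<in> space N. F x \<le> r})"
    proof (intro equalityI subsetI)
      fix x assume x: "x \<in> {x \<in> space N. F x < a}"
      then obtain r where "r \<in> \<rat>" "F x < r" "r < a"
        using Rats_dense_in_real by blast
      with x range[of x] show "x \<in> (\<Union>r\<in>\<rat> \<inter> {0<..<a}. {x \<in> space N. F x \<le> r})"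
        by (auto intro!: bexI[of _ r])
    qed auto
    also have "\<dots> \<in> sets N"
      using 3 by (intro sets.countable_UN'' countable_Int1 countable_rat levels) auto
    finally show ?thesis .
  qed
qed

text \<open>It suffices to bound \<open>F p\<close> by every level above \<open>F q\<close>. Such
  levels are positive, and those from 1 on are covered by the range.\<close>

lemma increasing_on_cube_levels:
  assumes range: "\<And>p. p \<in> cube K \<Longrightarrow> F p \<in> {0..1}"
    and levels: "\<And>p q \<alpha>. p \<in> cube K \<Longrightarrow> q \<in> cube K \<Longrightarrow> (\<And>i. i \<in> {1..K} \<Longrightarrow> p i \<le> q i) \<Longrightarrow>
      \<alpha> \<in> {0<..<1} \<Longrightarrow> F q \<le> \<alpha> \<Longrightarrow> F p \<le> \<alpha>"
  shows "increasing_on_cube K F"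
  unfolding increasing_on_cube_def
proof (intro ballI impI)
  fix p q assume pq: "p \<in> cube K" "q \<in> cube K" and le: "\<forall>i\<in>{1..K}. p i \<le> q i"
  show "F p \<le> F q"
  proof (rule dense_ge)
    fix \<alpha> assume "F q < \<alpha>"
    then show "F p \<le> \<alpha>"
      using levels[OF pq, of \<alpha>] le range[OF pq(1)] range[OF pq(2)] by (cases "\<alpha> < 1") auto
  qed
qed

text \<open>A larger function has smaller sublevel sets, so the probability bound passes from
  \<open>F\<close> upwards to \<open>G\<close>.\<close>

lemma ex_p_merging_dominated:
  assumes "finite_measure M" and F: "ex_p_merging M K F" and dom: "dominates K F G"
    and range: "\<And>p. p \<in> cube K \<Longrightarrow> G p \<in> {0..1}"
    and "increasing_on_cube K G" and meas: "G \<in> borel_measurable (cube_algebra K)"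
  shows "ex_p_merging M K G"
  unfolding ex_p_merging_def
proof (intro conjI ballI impI)
  fix \<alpha> :: real and P assume \<alpha>: "\<alpha> \<in> {0<..<1}" and P: "P \<in> uniform_vectors M K" and "exchangeable M K P"
  then have "measure M {w \<in> space M. F (P w) \<le> \<alpha>} \<le> \<alpha>"
    using F by (auto simp: ex_p_merging_def)
  moreover have "measure M {w \<in> space M. G (P w) \<le> \<alpha>} \<le> measure M {w \<in> space M. F (P w) \<le> \<alpha>}"
  proof (rule finite_measure.finite_measure_mono[OF assms(1)])
    have P_meas[measurable]: "P \<in> M \<rightarrow>\<^sub>M cube_algebra K"
      using P by (simp add: uniform_vectors_def)
    have [measurable]: "F \<in> borel_measurable (cube_algebra K)"
      using F by (simp add: ex_p_merging_def)
    show "{w \<in> space M. F (P w) \<le> \<alpha>} \<in> sets M"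
      by measurable
    show "{w \<in> space M. G (P w) \<le> \<alpha>} \<subseteq> {w \<in> space M. F (P w) \<le> \<alpha>}"
      using dom measurable_space[OF P_meas] unfolding dominates_def space_cube_algebra by force
  qed
  ultimately show "measure M {w \<in> space M. G (P w) \<le> \<alpha>} \<le> \<alpha>"
    by linarith
qed (use assms in auto)

lemma F_EG_range:
  assumes "p \<in> cube K" "1 \<le> K"
  shows "F_EG K p \<in> {0..1}"
proof -
  have "0 \<le> (MIN l\<in>{1..K}. MIN m\<in>{1..l}. exp (real l / real m) * geom_mean (smallest_vec p l m))"
    using assms geom_mean_nonneg[OF smallest_vec_nonneg] by (intro Min.boundedI) auto
  then show ?thesis
    using assms by (simp add: F_EG_eq)
qed

lemma F_EG'_range:
  assumes "p \<in> cube K" "1 \<le> K"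
  shows "F_EG' K p \<in> {0..1}"
proof -
  have "0 \<le> (MIN m\<in>{1..K}. geom_mean (prefix_vec p m))"
    using assms geom_mean_nonneg[OF prefix_vec_nonneg] by (intro Min.boundedI) auto
  then show ?thesis
    using assms by (simp add: F_EG'_eq)
qed

lemma geom_mean_prefix_vec_mono:
  assumes "p \<in> cube K" "m \<in> {1..K}" "\<And>i. i \<in> {1..K} \<Longrightarrow> p i \<le> q i"
  shows "geom_mean (prefix_vec p m) \<le> geom_mean (prefix_vec q m)"
  unfolding geom_mean_prefix_vec
  using assms by (intro real_root_le_mono prod_mono) (auto simp: cube_def PiE_iff)

lemma measurable_geom_mean_prefix_vec:
  assumes "m \<le> K"
  shows "(\<lambda>p. geom_mean (prefix_vec p m)) \<in> borel_measurable (cube_algebra K)"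
  unfolding geom_mean_prefix_vec
proof (rule measurable_compose[where g="root m"])
  show "(\<lambda>p. \<Prod>i=1..m. p i) \<in> borel_measurable (cube_algebra K)"
    using assms by (intro borel_measurable_prod measurable_cube_component) auto
  show "root m \<in> borel_measurable borel"
    by (intro borel_measurable_continuous_onI continuous_on_real_root continuous_on_id)
qed

section \<open>Validity of \<open>F_EG\<close>\<close>

lemma ex_p_merging_F_EG:
  assumes "1 \<le> K"
  shows "ex_p_merging M K (F_EG K)"
  unfolding ex_p_merging_def
proof (intro conjI ballI impI)
  define S where "S \<alpha> l p = (\<Sum>i=1..l. e2ennreal (max (log_ratio \<alpha> (p i)) 0))"
    for \<alpha> l and p :: "nat \<Rightarrow> real"
  have le_iff: "F_EG K p \<le> \<alpha> \<longleftrightarrow> (\<exists>l\<in>{1..K}. of_nat l \<le> S \<alpha> l p)"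
    if "p \<in> cube K" "\<alpha> \<in> {0<..<1}" for p \<alpha>
    using F_EG_le_iff_sum_ennreal[OF that(1) assms that(2)] by (simp add: S_def)
  show "F_EG K p \<in> {0..1}" if "p \<in> cube K" for p
    using that assms by (rule F_EG_range)
  show "increasing_on_cube K (F_EG K)"
  proof (rule increasing_on_cube_levels)
    fix p q \<alpha>
    assume pq: "p \<in> cube K" "q \<in> cube K" and le: "\<And>i. i \<in> {1..K} \<Longrightarrow> p i \<le> q i"
      and \<alpha>: "\<alpha> \<in> {0<..<1}" and "F_EG K q \<le> \<alpha>"
    then obtain l where l: "l \<in> {1..K}" "of_nat l \<le> S \<alpha> l q"
      by (auto simp: le_iff)
    note l(2)
    also have "S \<alpha> l q \<le> S \<alpha> l p"
      unfolding S_def using \<alpha> le l(1) pq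
      \<comment> \<open>Each log ratio is antitone in its p-value, so lowering the p-values can only
        help a sum reach its threshold.\<close>
      by (intro sum_mono e2ennreal_mono max.mono log_ratio_antimono) (auto simp: cube_def PiE_iff)
    finally show "F_EG K p \<le> \<alpha>"
      using l(1) le_iff[OF pq(1) \<alpha>] by blast
  qed (use F_EG_range assms in blast)
  have S_measurable: "S \<alpha> l \<in> borel_measurable (cube_algebra K)" if "l \<in> {1..K}" for \<alpha> l
    unfolding S_def
  proof (rule borel_measurable_sum)
    fix i assume "i \<in> {1..l}"
    with that have [measurable]: "(\<lambda>p. p i) \<in> borel_measurable (cube_algebra K)"
      by (intro measurable_cube_component) auto
    show "(\<lambda>p. e2ennreal (max (log_ratio \<alpha> (p i)) 0)) \<in> borel_measurable (cube_algebra K)"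
      by measurable
  qed
  have level_sets: "{p \<in> cube K. \<exists>l\<in>{1..K}. of_nat l \<le> S \<alpha> l p} \<in> sets (cube_algebra K)" for \<alpha>
  proof -
    have "{p \<in> space (cube_algebra K). of_nat l \<le> S \<alpha> l p} \<in> sets (cube_algebra K)"
      if "l \<in> {1..K}" for l
    proof -
      have [measurable]: "S \<alpha> l \<in> borel_measurable (cube_algebra K)"
        using that by (rule S_measurable)
      show ?thesis by measurable
    qed
    then have "{p \<in> space (cube_algebra K). \<exists>l\<in>{1..K}. of_nat l \<le> S \<alpha> l p} \<in> sets (cube_algebra K)"
      by (intro sets.sets_Collect_finite_Ex) auto
    then show ?thesis
      by (simp add: space_cube_algebra)
  qed
  show "F_EG K \<in> borel_measurable (cube_algebra K)"
    using level_sets F_EG_range[OF _ assms]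
    by (intro borel_measurable_unit_interval_levels) (auto simp: space_cube_algebra le_iff cong: conj_cong)
  fix \<alpha> :: real and P assume \<alpha>: "\<alpha> \<in> {0<..<1}" and P: "P \<in> uniform_vectors M K" and ex: "exchangeable M K P"
  have P_meas[measurable]: "P \<in> M \<rightarrow>\<^sub>M cube_algebra K"
    using P by (simp add: uniform_vectors_def)
  \<comment> \<open>The event depends on \<open>P\<close> alone, so it is moved to the law of
    \<open>P\<close>, where the Markov bound applies.\<close>
  define D where "D = distr M (cube_algebra K) P"
  have space_D: "space D = cube K"
    by (simp add: D_def space_cube_algebra)
  have "emeasure M {w \<in> space M. F_EG K (P w) \<le> \<alpha>} =
      emeasure D {p \<in> space D. \<exists>l\<in>{1..K}. of_nat l \<le> S \<alpha> l p}"
  proof -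
    have "P -` {p \<in> cube K. \<exists>l\<in>{1..K}. of_nat l \<le> S \<alpha> l p} \<inter> space M = {w \<in> space M. F_EG K (P w) \<le> \<alpha>}"
      using measurable_space[OF P_meas] le_iff[OF _ \<alpha>] unfolding space_cube_algebra by blast
    then show ?thesis
      unfolding space_D unfolding D_def emeasure_distr[OF P_meas level_sets] by (simp only:)
  qed
  also have "\<dots> \<le> (\<integral>\<^sup>+p. e2ennreal (max (log_ratio \<alpha> (p 1)) 0) \<partial>D)"
    unfolding S_def
  proof (rule exchangeable_Markov)
    show "sets D = sets (PiM {1..K} (\<lambda>_. restrict_space borel {0..1}))"
      by (simp add: D_def cube_algebra_def)
    show "(\<lambda>x. e2ennreal (max (log_ratio \<alpha> x) 0)) \<in> borel_measurable (restrict_space borel {0..1})"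
      by (intro measurable_restrict_space1) measurable
    fix \<pi> assume \<pi>: "\<pi> permutes {1..K}"
    have t: "(\<lambda>x. \<lambda>i\<in>{1..K}. x (\<pi> i)) \<in> cube_algebra K \<rightarrow>\<^sub>M cube_algebra K"
      unfolding cube_algebra_def using permutes_in_image[OF \<pi>]
      by (intro measurable_restrict measurable_component_singleton) auto
    have "distr D D (\<lambda>x. \<lambda>i\<in>{1..K}. x (\<pi> i)) = distr D (cube_algebra K) (\<lambda>x. \<lambda>i\<in>{1..K}. x (\<pi> i))"
      by (intro distr_cong) (auto simp: D_def)
    also have "\<dots> = distr M (cube_algebra K) (\<lambda>w. \<lambda>i\<in>{1..K}. P w (\<pi> i))"
      unfolding D_def by (subst distr_distr[OF t P_meas]) (simp add: comp_def)
    also have "\<dots> = D"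
      using ex \<pi> by (simp add: exchangeable_def D_def)
    finally show "distr D D (\<lambda>x. \<lambda>i\<in>{1..K}. x (\<pi> i)) = D" .
  qed
  \<comment> \<open>Only the first coordinate is left in the bound, so the joint law reduces to a
    uniform marginal.\<close>
  also have "\<dots> = (\<integral>\<^sup>+w. e2ennreal (max (log_ratio \<alpha> (P w 1)) 0) \<partial>M)"
  proof -
    have [measurable]: "(\<lambda>p. p 1) \<in> borel_measurable (cube_algebra K)"
      using assms by (intro measurable_cube_component) auto
    show ?thesis
      unfolding D_def by (rule nn_integral_distr) measurable
  qed
  also have "\<dots> = (\<integral>\<^sup>+x. e2ennreal (max (log_ratio \<alpha> x) 0) \<partial>distr M borel (\<lambda>w. P w 1))"
  proof -
    have [measurable]: "(\<lambda>w. P w 1) \<in> borel_measurable M"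
      using assms by (intro measurable_compose[OF P_meas measurable_cube_component]) auto
    show ?thesis
      by (rule nn_integral_distr[symmetric]) measurable
  qed
  also have "distr M borel (\<lambda>w. P w 1) = unif01"
    using P assms by (auto simp: uniform_vectors_def)
  also have "(\<integral>\<^sup>+x. e2ennreal (max (log_ratio \<alpha> x) 0) \<partial>unif01) = ennreal \<alpha>"
    using \<alpha> by (rule nn_integral_log_ratio)
  finally show "measure M {w \<in> space M. F_EG K (P w) \<le> \<alpha>} \<le> \<alpha>"
    using \<alpha> by (simp add: measure_def enn2real_leI)
qed

section \<open>The dominations and the validity inherited along them\<close>

lemma dominates_F_EG_F_EG':
  assumes "1 \<le> K"
  shows "dominates K (F_EG K) (F_EG' K)"
  unfolding dominates_def
proof
  fix p assume p: "p \<in> cube K"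
  \<comment> \<open>Comparing sublevel sets avoids the nested minima: below level 1 the claim is
    \<open>z \<le> max z 0\<close> in each summand.\<close>
  show "F_EG K p \<le> F_EG' K p"
  proof (rule dense_ge)
    fix \<alpha> assume gt: "F_EG' K p < \<alpha>"
    show "F_EG K p \<le> \<alpha>"
    proof (cases "\<alpha> < 1")
      case True
      with gt have \<alpha>: "\<alpha> \<in> {0<..<1}"
        using F_EG'_range[OF p assms] by auto
      with gt obtain l where "l \<in> {1..K}" "ereal (real l) \<le> (\<Sum>i=1..l. log_ratio \<alpha> (p i))"
        using F_EG'_le_iff_sum[OF p assms \<alpha>] by auto
      moreover have "(\<Sum>i=1..l. log_ratio \<alpha> (p i)) \<le> (\<Sum>i=1..l. max (log_ratio \<alpha> (p i)) 0)"
        by (intro sum_mono) auto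
      ultimately show ?thesis
        using F_EG_le_iff_sum[OF p assms \<alpha>] order_trans by blast
    next
      case False
      then show ?thesis
        using F_EG_range[OF p assms] by auto
    qed
  qed
qed

lemma dominates_F_EG'_F_G':
  assumes "1 \<le> K"
  shows "dominates K (F_EG' K) (F_G' K)"
  unfolding dominates_def
proof
  fix p assume p: "p \<in> cube K"
  have "(MIN m\<in>{1..K}. geom_mean (prefix_vec p m)) \<le> geom_mean (prefix_vec p K)"
    using assms by (intro Min_le) auto
  then show "F_EG' K p \<le> F_G' K p"
    using p assms by (simp add: F_EG'_eq F_G'_def min.coboundedI1)
qed

text \<open>Capping keeps a domination from below by a function bounded by 1; this lets validity
  pass on to the capped \<open>F_G'\<close>.\<close>

lemma dominates_trunc1:
  assumes "dominates K F G" "\<And>p. p \<in> cube K \<Longrightarrow> F p \<le> 1"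
  shows "dominates K F (trunc1 G)"
  using assms by (auto simp: dominates_def trunc1_def)

lemma ex_p_merging_F_EG':
  assumes "finite_measure M" "1 \<le> K"
  shows "ex_p_merging M K (F_EG' K)"
proof (rule ex_p_merging_dominated[OF assms(1) ex_p_merging_F_EG dominates_F_EG_F_EG'])
  have range: "F_EG' K p \<in> {0..1}" if "p \<in> cube K" for p
    using that assms(2) by (rule F_EG'_range)
  then show "F_EG' K p \<in> {0..1}" if "p \<in> cube K" for p
    using that .
  show "increasing_on_cube K (F_EG' K)"
  proof (rule increasing_on_cube_levels)
    fix p q \<alpha>
    assume pq: "p \<in> cube K" "q \<in> cube K" and le: "\<And>i. i \<in> {1..K} \<Longrightarrow> p i \<le> q i"
      and \<alpha>: "\<alpha> \<in> {0<..<1}" and "F_EG' K q \<le> \<alpha>"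
    then obtain m where m: "m \<in> {1..K}" "exp 1 * geom_mean (prefix_vec q m) \<le> \<alpha>"
      using F_EG'_le_iff[OF pq(2) assms(2) \<alpha>] by blast
    have "exp 1 * geom_mean (prefix_vec p m) \<le> exp 1 * geom_mean (prefix_vec q m)"
      using geom_mean_prefix_vec_mono[OF pq(1) m(1) le] by simp
    with m show "F_EG' K p \<le> \<alpha>"
      using F_EG'_le_iff[OF pq(1) assms(2) \<alpha>] order_trans by blast
  qed (rule range)
  show "F_EG' K \<in> borel_measurable (cube_algebra K)"
  proof (rule borel_measurable_unit_interval_levels)
    fix \<alpha> :: real assume \<alpha>: "\<alpha> \<in> {0<..<1}"
    have "{p \<in> space (cube_algebra K). exp 1 * geom_mean (prefix_vec p m) \<le> \<alpha>} \<in> sets (cube_algebra K)"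
      if "m \<in> {1..K}" for m
    proof -
      have [measurable]: "(\<lambda>p. geom_mean (prefix_vec p m)) \<in> borel_measurable (cube_algebra K)"
        using that by (intro measurable_geom_mean_prefix_vec) auto
      show ?thesis by measurable
    qed
    then have "{p \<in> space (cube_algebra K). \<exists>m\<in>{1..K}. exp 1 * geom_mean (prefix_vec p m) \<le> \<alpha>}
        \<in> sets (cube_algebra K)"
      by (intro sets.sets_Collect_finite_Ex) auto
    then show "{p \<in> space (cube_algebra K). F_EG' K p \<le> \<alpha>} \<in> sets (cube_algebra K)"
      using F_EG'_le_iff[OF _ assms(2) \<alpha>] by (simp add: space_cube_algebra cong: conj_cong)
  qed (simp only: space_cube_algebra range)
qed (use assms in auto)

lemma ex_p_merging_trunc1_F_G':
  assumes "finite_measure M" "1 \<le> K"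
  shows "ex_p_merging M K (trunc1 (F_G' K))"
proof (rule ex_p_merging_dominated[OF assms(1) ex_p_merging_F_EG'[OF assms]])
  show "dominates K (F_EG' K) (trunc1 (F_G' K))"
    using assms(2) F_EG'_range by (intro dominates_trunc1 dominates_F_EG'_F_G') auto
  show "trunc1 (F_G' K) p \<in> {0..1}" if "p \<in> cube K" for p
    using geom_mean_nonneg[OF prefix_vec_nonneg[OF that order_refl]] by (simp add: trunc1_def F_G'_def)
  show "increasing_on_cube K (trunc1 (F_G' K))"
    unfolding increasing_on_cube_def
  proof (intro ballI impI)
    fix p q assume "p \<in> cube K" "\<forall>i\<in>{1..K}. p i \<le> q i"
    then have "geom_mean (prefix_vec p K) \<le> geom_mean (prefix_vec q K)"
      using assms(2) by (intro geom_mean_prefix_vec_mono) auto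
    then show "trunc1 (F_G' K) p \<le> trunc1 (F_G' K) q"
      unfolding trunc1_def F_G'_def by (intro min.mono) auto
  qed
  have [measurable]: "(\<lambda>p. geom_mean (prefix_vec p K)) \<in> borel_measurable (cube_algebra K)"
    by (rule measurable_geom_mean_prefix_vec) simp
  show "trunc1 (F_G' K) \<in> borel_measurable (cube_algebra K)"
    unfolding trunc1_def[abs_def] F_G'_def by measurable
qed

section \<open>Points where the dominations are strict\<close>

lemma strictly_dominates_F_EG_F_EG':
  assumes "2 \<le> K"
  shows "strictly_dominates K (F_EG K) (F_EG' K)"
  unfolding strictly_dominates_def
proof (intro conjI bexI)
  show "dominates K (F_EG K) (F_EG' K)"
    using assms by (intro dominates_F_EG_F_EG') auto
  \<comment> \<open>At level \<open>exp (-2)\<close> the log ratios are -2, 2, -2, -2 and so on. The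
    positive parts sum to 2 at \<open>l = 2\<close>, so that average is 1. The signed sum is -2 for
    \<open>l = 1\<close> and \<open>4 - 2 * l\<close> from \<open>l = 2\<close> on, always below
    \<open>l\<close>.\<close>
  define p :: "nat \<Rightarrow> real" where "p = (\<lambda>i\<in>{1..K}. if i = 2 then exp (-4) else 1)"
  define \<alpha> :: real where "\<alpha> = exp (-2)"
  show p: "p \<in> cube K"
    by (auto simp: p_def cube_def)
  have \<alpha>: "\<alpha> \<in> {0<..<1}"
    by (simp add: \<alpha>_def)
  have K: "1 \<le> K"
    using assms by simp
  have log_ratio_p: "log_ratio \<alpha> (p i) = ereal (if i = 2 then 2 else -2)" if "i \<in> {1..K}" for i
  proof -
    have "ln (\<alpha> / exp (-4)) = 2" "ln \<alpha> = -2"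
      by (simp_all add: \<alpha>_def ln_div)
    then show ?thesis
      using that by (simp add: p_def log_ratio_def)
  qed
  have "(\<Sum>i=1..2. max (log_ratio \<alpha> (p i)) 0) = (\<Sum>i=1..2::nat. ereal (if i = 2 then 2 else 0))"
    using assms log_ratio_p by (intro sum.cong) auto
  also have "\<dots> = ereal (real 2)"
    by (simp add: numeral_2_eq_2)
  finally have "F_EG K p \<le> \<alpha>"
    using assms unfolding F_EG_le_iff_sum[OF p K \<alpha>] by (intro bexI[of _ 2]) auto
  moreover have "\<not> F_EG' K p \<le> \<alpha>"
    unfolding F_EG'_le_iff_sum[OF p K \<alpha>]
  proof (rule notI, elim bexE)
    fix l assume l: "l \<in> {1..K}" and "ereal (real l) \<le> (\<Sum>i=1..l. log_ratio \<alpha> (p i))"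
    moreover have "(\<Sum>i=1..l. log_ratio \<alpha> (p i)) = (\<Sum>i=1..l. ereal (if i = 2 then 2 else -2))"
      using l log_ratio_p by (intro sum.cong) auto
    ultimately have "real l \<le> (\<Sum>i=1..l. if i = 2 then 2 else -2)"
      by simp
    also have "\<dots> = (\<Sum>i=1..l. (if i = 2 then 4 else 0) - 2)"
      by (intro sum.cong) auto
    also have "\<dots> = (if 2 \<le> l then 4 else 0) - 2 * real l"
      by (simp add: sum_subtractf)
    finally show False
      using l by (auto split: if_splits)
  qed
  ultimately show "F_EG K p < F_EG' K p"
    by simp
qed

text \<open>Separating the two values by 1 makes the same point serve for both \<open>F_G'\<close>
  and its truncation.\<close>

lemma F_EG'_less_F_G':
  assumes "2 \<le> K"
  obtains p where "p \<in> cube K" "F_EG' K p < 1" "1 \<le> F_G' K p"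
proof
  \<comment> \<open>The prefix of length 1 already gives \<open>exp 1 * exp (-2) = exp (-1)\<close>.
    Over all \<open>K\<close> entries the small one is diluted to \<open>exp (1 - 2 / K)\<close>,
    which is at least 1 exactly because \<open>K \<ge> 2\<close>.\<close>
  define p :: "nat \<Rightarrow> real" where "p = (\<lambda>i\<in>{1..K}. if i = 1 then exp (-2) else 1)"
  show p: "p \<in> cube K"
    by (auto simp: p_def cube_def)
  have "ereal (real 1) \<le> (\<Sum>i=1..1. log_ratio (exp (-1)) (p i))"
    using assms by (simp add: p_def log_ratio_def ln_div)
  then have "F_EG' K p \<le> exp (-1)"
    using assms by (subst F_EG'_le_iff_sum[OF p]) force+
  also have "exp (-1) < (1::real)"
    by simp
  finally show "F_EG' K p < 1" .
  have "(\<Prod>i=1..K. p i) = (\<Prod>i=1..K. if i = 1 then exp (-2) else 1)"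
    by (intro prod.cong) (auto simp: p_def)
  also have "\<dots> = exp (-2)"
    using assms by simp
  finally have "F_G' K p = exp (1 - 2 / real K)"
    using assms by (simp add: F_G'_def geom_mean_prefix_vec root_powr_inverse powr_def field_simps flip: exp_add)
  then show "1 \<le> F_G' K p"
    using assms by (simp add: field_simps)
qed

theorem theorem8p1:
  fixes M :: "'w measure" and K :: nat
  assumes "atomless_prob_space M" and "K \<ge> 2"
  shows "ex_p_merging M K (F_EG K)
    \<and> ex_p_merging M K (F_EG' K)
    \<and> ex_p_merging M K (trunc1 (F_G' K))
    \<and> strictly_dominates K (F_EG K) (F_EG' K)
    \<and> strictly_dominates K (F_EG' K) (F_G' K)
    \<and> strictly_dominates K (F_EG' K) (trunc1 (F_G' K))
    \<and> (\<forall>p\<in>cube K.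
         F_EG' K p = min (exp 1 * (MIN m\<in>{1..K}. geom_mean (prefix_vec p m))) 1)
    \<and> (\<forall>p\<in>cube K.
         F_EG K p = min (MIN l\<in>{1..K}. MIN m\<in>{1..l}.
           exp (real l / real m) * geom_mean (smallest_vec p l m)) 1)"
proof -
  have K: "1 \<le> K"
    using assms(2) by simp
  have finite: "finite_measure M"
    using assms(1) by (auto simp: atomless_prob_space_def prob_space_def)
  obtain p where p: "p \<in> cube K" "F_EG' K p < 1" "1 \<le> F_G' K p"
    using F_EG'_less_F_G'[OF assms(2)] .
  have "strictly_dominates K (F_EG' K) (F_G' K)"
    unfolding strictly_dominates_def using p dominates_F_EG'_F_G'[OF K]
    by (intro conjI bexI[of _ p]) auto
  moreover have "strictly_dominates K (F_EG' K) (trunc1 (F_G' K))"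
    unfolding strictly_dominates_def
    using p dominates_trunc1[OF dominates_F_EG'_F_G'[OF K]] F_EG'_range[OF _ K]
    by (intro conjI bexI[of _ p]) (auto simp: trunc1_def)
  ultimately show ?thesis
    using K finite assms(2)
    by (intro conjI ballI ex_p_merging_F_EG ex_p_merging_F_EG' ex_p_merging_trunc1_F_G'
      strictly_dominates_F_EG_F_EG' F_EG'_eq F_EG_eq) auto
qed

end
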